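(* Fix $M$ and an order $(m_1,\ldots,m_k)$. For every parking configuration $C$ of order $(m_1,\ldots,m_k)$ there is exactly one set of the form $\mathrm{fam}(\alpha)$, with $\alpha$ an exact $k$-typed parking function of order $(m_1,\ldots,m_k)$, such that $\alpha$ results in $C$. (That is, some exact $k$-TPF $\alpha$ of this order results in $C$, and if $\alpha,\gamma$ are exact $k$-TPFs of this order both resulting in $C$, then $\mathrm{fam}(\alpha)=\mathrm{fam}(\gamma)$.)
   Context: $m_1,\ldots,m_k$ are positive integers with $m_1+\cdots+m_k=M$. There are $M$ cars, $m_i$ of them of type $i$, and $M$ parking spots in a row. Consider tuples $\alpha=(m_1;P_2,\ldots,P_k)$, where each $P_i=(p^{(i)}_1,\ldots,p^{(i)}_{m_i})$ is an ordered list of nonnegative integers (for $k=1$, $\alpha=(m_1)$). Such an $\alpha$ is an exact $k$-typed parking function (exact $k$-TPF) of order $(m_1,\ldots,m_k)$ if there is an arrangement of the $M$ cars in the $M$ spots, one car per spot, such that for all $2\le i\le k$ and $1\le j\le m_i$ the $j$-th car of type $i$ has exactly $p^{(i)}_j$ cars of types in $\{1,\ldots,i-1\}$ parked before it. A parking configuration of order $(m_1,\ldots,m_k)$ is a word $C$ of length $M$ in the letters $1,\ldots,k$ in which each letter $i$ occurs exactly $m_i$ times; $\alpha$ results in $C$ if $C$ is the word of types of the cars, read from spot $1$ to spot $M$, in such an arrangement. An exact $k$-TPF $\beta=(m_1;Q_2,\ldots,Q_k)$ is a parking permutation of $\alpha=(m_1;P_2,\ldots,P_k)$ if for every $i=2,\ldots,k$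 the list $Q_i$ is a rearrangement of the list $P_i$. $\mathrm{fam}(\alpha)$ is the set of all parking permutations of $\alpha$ (including $\alpha$ itself). *)

theory Defs
  imports "HOL-Library.Multiset"
begin

text \<open>
  An order $(m_1,\ldots,m_k)$ is a list \<open>ms\<close> with \<open>k = length ms\<close> and \<open>M = sum_list ms\<close>;
  types, car numbers and spots are counted from 1, list positions from 0.
\<close>

definition num_cars :: "nat list \<Rightarrow> nat \<Rightarrow> nat" where
  "num_cars ms i = ms ! (i - 1)"

definition is_order :: "nat list \<Rightarrow> bool" where
  "is_order ms \<longleftrightarrow> ms \<noteq> [] \<and> (\<forall>i\<in>{1..length ms}. num_cars ms i > 0)"

text \<open>The car \<open>(i, j)\<close> is the \<open>j\<close>-th car of type \<open>i\<close>.\<close>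

type_synonym car = "nat \<times> nat"

definition cars :: "nat list \<Rightarrow> car set" where
  "cars ms = {(i, j). i \<in> {1..length ms} \<and> j \<in> {1..num_cars ms i}}"

text \<open>In an arrangement \<open>cs\<close>, the car in spot \<open>s\<close> is \<open>cs ! (s - 1)\<close>.\<close>

definition arrangement :: "nat list \<Rightarrow> car list \<Rightarrow> bool" where
  "arrangement ms cs \<longleftrightarrow> length cs = sum_list ms \<and> distinct cs \<and> set cs = cars ms"

definition lower_before :: "car list \<Rightarrow> car \<Rightarrow> nat" where
  "lower_before cs c =
     length (filter (\<lambda>d. fst d < fst c) (takeWhile (\<lambda>d. d \<noteq> c) cs))"

text \<open>
  The tuple $(m_1; P_2, \ldots, P_k)$ is represented by \<open>(m\<^sub>1, [P\<^sub>2, \<dots>, P\<^sub>k])\<close>, so that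
  $P_i$ is at position \<open>i - 2\<close> of the second component.
\<close>

type_synonym typed_tuple = "nat \<times> nat list list"

definition pref_list :: "typed_tuple \<Rightarrow> nat \<Rightarrow> nat list" where
  "pref_list \<alpha> i = snd \<alpha> ! (i - 2)"

definition has_order :: "nat list \<Rightarrow> typed_tuple \<Rightarrow> bool" where
  "has_order ms \<alpha> \<longleftrightarrow>
     fst \<alpha> = num_cars ms 1 \<and> length (snd \<alpha>) = length ms - 1 \<and>
     (\<forall>i\<in>{2..length ms}. length (pref_list \<alpha> i) = num_cars ms i)"

definition realized_by :: "nat list \<Rightarrow> typed_tuple \<Rightarrow> car list \<Rightarrow> bool" where
  "realized_by ms \<alpha> cs \<longleftrightarrow> arrangement ms cs \<and>
     (\<forall>i\<in>{2..length ms}. \<forall>j\<in>{1..num_cars ms i}.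
        lower_before cs (i, j) = pref_list \<alpha> i ! (j - 1))"

definition exact_tpf :: "nat list \<Rightarrow> typed_tuple \<Rightarrow> bool" where
  "exact_tpf ms \<alpha> \<longleftrightarrow> has_order ms \<alpha> \<and> (\<exists>cs. realized_by ms \<alpha> cs)"

definition parking_configuration :: "nat list \<Rightarrow> nat list \<Rightarrow> bool" where
  "parking_configuration ms C \<longleftrightarrow>
     length C = sum_list ms \<and> set C \<subseteq> {1..length ms} \<and>
     (\<forall>i\<in>{1..length ms}. count_list C i = num_cars ms i)"

definition results_in :: "nat list \<Rightarrow> typed_tuple \<Rightarrow> nat list \<Rightarrow> bool" where
  "results_in ms \<alpha> C \<longleftrightarrow> (\<exists>cs. realized_by ms \<alpha> cs \<and> C = map fst cs)"

definition parking_permutation :: "nat list \<Rightarrow> typed_tuple \<Rightarrow> typed_tuple \<Rightarrow> bool" where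
  "parking_permutation ms \<beta> \<alpha> \<longleftrightarrow> exact_tpf ms \<beta> \<and>
     (\<forall>i\<in>{2..length ms}. mset (pref_list \<beta> i) = mset (pref_list \<alpha> i))"

definition fam :: "nat list \<Rightarrow> typed_tuple \<Rightarrow> typed_tuple set" where
  "fam ms \<alpha> = {\<beta>. parking_permutation ms \<beta> \<alpha>}"

end

theory Submission
  imports Defs
begin

text \<open>
  In an arrangement, the preference of a car is the number of cars of smaller type before it, and
  this number can be read off from the types alone, once the spot of the car is known. Hence the
  configuration \<open>C\<close> determines, for each type \<open>i\<close>, the multiset of the preferences of the cars of
  type \<open>i\<close>: one value for each spot at which \<open>C\<close> has the letter \<open>i\<close> (\<open>mset_pref_list\<close>). What \<open>C\<close>
  leaves open is only which car of type \<open>i\<close> stands at which of these spots, that is, the order of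
  the list \<open>P\<^sub>i\<close>. A family is determined by exactly these multisets (\<open>fam_cong\<close>), so all tuples that
  result in \<open>C\<close> have the same family.

  Conversely, some tuple results in \<open>C\<close>: number the cars of each type from left to right to get an
  arrangement with type word \<open>C\<close> (\<open>arrangement_exists\<close>), and let each car prefer the number of
  smaller types that it sees before it (\<open>arrangement_realizes_tuple\<close>).
\<close>

definition type_spots :: "nat list \<Rightarrow> nat \<Rightarrow> nat multiset" where
  "type_spots C i = filter_mset (\<lambda>s. C ! s = i) (mset [0..<length C])"

definition smaller_types_before :: "nat list \<Rightarrow> nat \<Rightarrow> nat \<Rightarrow> nat" where
  "smaller_types_before C i s = length (filter (\<lambda>t. t < i) (take s C))"

text \<open>
  As no car occurs twice, the search from the left for the car in spot \<open>s\<close> stops at \<open>s\<close> itself;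
  of the cars passed on the way only the types are counted.
\<close>

lemma lower_before_nth:
  assumes "distinct cs" "s < length cs"
  shows "lower_before cs (cs ! s) = smaller_types_before (map fst cs) (fst (cs ! s)) s"
proof -
  have "takeWhile (\<lambda>d. d \<noteq> cs ! s) cs = take s cs"
    using assms by (intro takeWhile_eq_take_P_nth) (auto simp: nth_eq_iff_index_eq)
  then show ?thesis
    by (simp add: lower_before_def smaller_types_before_def take_map filter_map o_def)
qed

text \<open>
  Both sides collect the values \<open>lower_before\<close> over the cars of type \<open>i\<close>, on the left in the order
  of their numbers, on the right in the order of their spots.
\<close>

lemma mset_pref_list:
  assumes ord: "has_order ms \<alpha>" and real: "realized_by ms \<alpha> cs" and i: "i \<in> {2..length ms}"
  shows "mset (pref_list \<alpha> i) =
    image_mset (smaller_types_before (map fst cs) i) (type_spots (map fst cs) i)"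
proof -
  let ?m = "num_cars ms i"
  have dist: "distinct cs" and set_cs: "set cs = cars ms"
    using real by (auto simp: realized_by_def arrangement_def)
  have len: "length (pref_list \<alpha> i) = ?m"
    using ord i by (auto simp: has_order_def)
  have "pref_list \<alpha> i = map (\<lambda>j. lower_before cs (i, j)) [1..<Suc ?m]"
    using real i len by (intro nth_equalityI) (auto simp: realized_by_def simp del: upt_Suc)
  then have "mset (pref_list \<alpha> i) =
      image_mset (lower_before cs) (mset (map (Pair i) [1..<Suc ?m]))"
    by (simp add: multiset.map_comp o_def del: upt_Suc)
  also have "mset (map (Pair i) [1..<Suc ?m]) = mset (filter (\<lambda>c. fst c = i) cs)"
  proof -
    have "set (map (Pair i) [1..<Suc ?m]) = set (filter (\<lambda>c. fst c = i) cs)"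
      using i by (auto simp: set_cs cars_def simp del: upt_Suc)
    moreover have "distinct (map (Pair i) [1..<Suc ?m])"
      by (simp add: distinct_map inj_on_def del: upt_Suc)
    ultimately show ?thesis
      using dist by (simp only: set_eq_iff_mset_eq_distinct distinct_filter)
  qed
  also have "mset (filter (\<lambda>c. fst c = i) cs) =
      image_mset ((!) cs) (type_spots (map fst cs) i)"
  proof -
    have "mset (filter (\<lambda>c. fst c = i) cs) =
        filter_mset (\<lambda>c. fst c = i) (image_mset ((!) cs) (mset [0..<length cs]))"
      by (simp only: mset_filter map_nth flip: mset_map)
    also have "\<dots> = image_mset ((!) cs)
        (filter_mset (\<lambda>s. fst (cs ! s) = i) (mset [0..<length cs]))"
      by (simp add: filter_mset_image_mset)
    also have "filter_mset (\<lambda>s. fst (cs ! s) = i) (mset [0..<length cs]) =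
        type_spots (map fst cs) i"
      unfolding type_spots_def by (auto intro!: filter_mset_cong)
    finally show ?thesis .
  qed
  also have "image_mset (lower_before cs) (image_mset ((!) cs) (type_spots (map fst cs) i)) =
      image_mset (smaller_types_before (map fst cs) i) (type_spots (map fst cs) i)"
    unfolding multiset.map_comp
    by (intro image_mset_cong) (auto simp: type_spots_def lower_before_nth dist)
  finally show ?thesis .
qed

lemma fam_cong:
  assumes "\<And>i. i \<in> {2..length ms} \<Longrightarrow> mset (pref_list \<alpha> i) = mset (pref_list \<gamma> i)"
  shows "fam ms \<alpha> = fam ms \<gamma>"
  using assms by (auto simp: fam_def parking_permutation_def)

lemma fam_eq_if_same_result:
  assumes "exact_tpf ms \<alpha>" "results_in ms \<alpha> C" "exact_tpf ms \<gamma>" "results_in ms \<gamma> C"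
  shows "fam ms \<alpha> = fam ms \<gamma>"
proof -
  obtain cs where cs: "realized_by ms \<alpha> cs" "C = map fst cs"
    using assms(2) by (auto simp: results_in_def)
  obtain ds where ds: "realized_by ms \<gamma> ds" "C = map fst ds"
    using assms(4) by (auto simp: results_in_def)
  have "has_order ms \<alpha>" "has_order ms \<gamma>"
    using assms by (auto simp: exact_tpf_def)
  then have "mset (pref_list \<alpha> i) = mset (pref_list \<gamma> i)" if "i \<in> {2..length ms}" for i
    using mset_pref_list[OF _ cs(1) that] mset_pref_list[OF _ ds(1) that] cs(2) ds(2) by simp
  then show ?thesis
    by (rule fam_cong)
qed

text \<open>
  The car appended for a last letter \<open>x\<close> gets the first number not yet used for type \<open>x\<close>, so the
  cars of each type are numbered from left to right.
\<close>

lemma left_to_right_numbering_exists: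
  "\<exists>cs. map fst cs = C \<and> distinct cs \<and> set cs = {(i, j). j \<in> {1..count_list C i}}"
proof (induction C rule: rev_induct)
  case Nil
  then show ?case by simp
next
  case (snoc x C)
  then obtain cs where cs: "map fst cs = C" "distinct cs"
      "set cs = {(i, j). j \<in> {1..count_list C i}}"
    by blast
  have "set (cs @ [(x, Suc (count_list C x))]) = {(i, j). j \<in> {1..count_list (C @ [x]) i}}"
    using cs(3) by (auto split: if_splits)
  moreover have "distinct (cs @ [(x, Suc (count_list C x))])"
    using cs by simp
  ultimately show ?case
    using cs(1) by (intro exI[of _ "cs @ [(x, Suc (count_list C x))]"]) simp
qed

lemma arrangement_exists:
  assumes "parking_configuration ms C"
  obtains cs where "arrangement ms cs" "map fst cs = C"
proof -
  obtain cs where cs: "map fst cs = C" "distinct cs"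
      "set cs = {(i, j). j \<in> {1..count_list C i}}"
    using left_to_right_numbering_exists[of C] by (elim exE conjE)
  have "length cs = sum_list ms"
    using assms cs(1) by (auto simp: parking_configuration_def)
  moreover have "set cs = cars ms"
  proof -
    have numbers: "{1..count_list C i} = (if i \<in> {1..length ms} then {1..num_cars ms i} else {})" for i
    proof (cases "i \<in> {1..length ms}")
      case True
      then have "count_list C i = num_cars ms i"
        using assms by (simp only: parking_configuration_def)
      then show ?thesis
        using True by simp
    next
      case False
      then have "i \<notin> set C"
        using assms unfolding parking_configuration_def by blast
      then have "count_list C i = 0"
        by (rule count_notin)
      then show ?thesis
        using False by (simp only: if_False) simp
    qed
    show ?thesis
      unfolding cs(3) cars_def numbers by (auto split: if_splits)
  qed
  ultimately have "arrangement ms cs"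
    using cs(2) by (simp add: arrangement_def)
  then show ?thesis
    using cs(1) by (rule that)
qed

lemma arrangement_realizes_tuple:
  assumes "arrangement ms cs"
  obtains \<alpha> where "has_order ms \<alpha>" "realized_by ms \<alpha> cs"
proof -
  define P where "P i = map (\<lambda>j. lower_before cs (i, j)) [1..<Suc (num_cars ms i)]" for i
  define \<alpha> where "\<alpha> = (num_cars ms 1, map P [2..<Suc (length ms)])"
  have pref: "pref_list \<alpha> i = P i" if "i \<in> {2..length ms}" for i
  proof -
    have "i - 2 < length [2..<Suc (length ms)]" "[2..<Suc (length ms)] ! (i - 2) = i"
      using that by (auto simp del: upt_Suc)
    then show ?thesis
      by (simp add: \<alpha>_def pref_list_def del: upt_Suc)
  qed
  have "has_order ms \<alpha>"
    using pref by (auto simp: has_order_def \<alpha>_def P_def simp del: upt_Suc)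
  moreover have "realized_by ms \<alpha> cs"
    using assms pref by (auto simp: realized_by_def P_def simp del: upt_Suc)
  ultimately show ?thesis
    by (rule that)
qed

theorem proposition4p4:
  fixes ms :: "nat list" and C :: "nat list"
  assumes "is_order ms"
    and "parking_configuration ms C"
  shows "\<exists>!F. \<exists>\<alpha>. exact_tpf ms \<alpha> \<and> F = fam ms \<alpha> \<and> results_in ms \<alpha> C"
proof -
  obtain cs where cs: "arrangement ms cs" "map fst cs = C"
    using assms(2) by (rule arrangement_exists)
  obtain \<alpha> where \<alpha>: "has_order ms \<alpha>" "realized_by ms \<alpha> cs"
    using cs(1) by (rule arrangement_realizes_tuple)
  have "exact_tpf ms \<alpha>" "results_in ms \<alpha> C"
    using \<alpha> cs(2) by (auto simp: exact_tpf_def results_in_def)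
  then show ?thesis
    using fam_eq_if_same_result by blast
qed

end
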